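(* Let $ABC$ be a triangle with centroid $M$ and medians $AD$, $BE$, $CF$, where $D$ is on $BC$, $E$ on $CA$, $F$ on $AB$. Let $r_1$ be the radius of the excircle of $\triangle BMD$ that touches side $BD$, $r_2$ the radius of the excircle of $\triangle CMD$ that touches side $DC$, $r_3$ the radius of the excircle of $\triangle CME$ that touches side $CE$, $r_4$ the radius of the excircle of $\triangle AME$ that touches side $EA$, $r_5$ the radius of the excircle of $\triangle AMF$ that touches side $AF$, and $r_6$ the radius of the excircle of $\triangle BMF$ that touches side $FB$. Then $$\frac{1}{r_1}+\frac{1}{r_3}+\frac{1}{r_5}=\frac{1}{r_2}+\frac{1}{r_4}+\frac{1}{r_6}.$$
   Context: The excircle of a triangle that touches a given side is the circle tangent to that side (segment) and to the extensions of the other two sides, lying on the opposite side of that segment from the remaining vertex. *)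

theory Defs
  imports "HOL-Analysis.Analysis"
begin

definition centroid :: "real^2 \<Rightarrow> real^2 \<Rightarrow> real^2 \<Rightarrow> real^2" where
  "centroid A B C = (1/3) *\<^sub>R (A + B + C)"

text \<open>The circle is \<^term>\<open>sphere c r\<close>. In the plane, for \<^prop>\<open>r > 0\<close>, a line is tangent
  to a circle exactly if it meets it in a single point, the point of tangency.\<close>

definition circle_tangent_at :: "real^2 \<Rightarrow> real \<Rightarrow> (real^2) set \<Rightarrow> real^2 \<Rightarrow> bool" where
  "circle_tangent_at c r L T \<longleftrightarrow> r > 0 \<and> sphere c r \<inter> L = {T}"

text \<open>\<open>is_excircle P Q R c r\<close>: the circle with centre \<open>c\<close> and radius \<open>r\<close> is the excircle of the
  triangle \<open>PQR\<close> that touches the side \<open>QR\<close>. The extension of a side is its line without the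
  side itself. The last conjunct says that the circle lies on the side of the line \<open>QR\<close> opposite
  to \<open>P\<close>: going from \<open>P\<close> to a point of the circle one meets that line (for the point of tangency
  with \<open>QR\<close>, at the endpoint).\<close>

definition is_excircle :: "real^2 \<Rightarrow> real^2 \<Rightarrow> real^2 \<Rightarrow> real^2 \<Rightarrow> real \<Rightarrow> bool" where
  "is_excircle P Q R c r \<longleftrightarrow>
     (\<exists>T \<in> closed_segment Q R. circle_tangent_at c r (affine hull {Q, R}) T) \<and>
     (\<exists>T \<in> affine hull {P, Q} - closed_segment P Q. circle_tangent_at c r (affine hull {P, Q}) T) \<and>
     (\<exists>T \<in> affine hull {P, R} - closed_segment P R. circle_tangent_at c r (affine hull {P, R}) T) \<and>
     (\<forall>X \<in> sphere c r. closed_segment P X \<inter> affine hull {Q, R} \<noteq> {})"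

definition is_exradius :: "real^2 \<Rightarrow> real^2 \<Rightarrow> real^2 \<Rightarrow> real \<Rightarrow> bool" where
  "is_exradius P Q R r \<longleftrightarrow> (\<exists>c. is_excircle P Q R c r)"

end

theory Submission
  imports Defs
begin

text \<open>If \<open>c\<close> is the centre of the excircle of \<open>PQR\<close> touching \<open>QR\<close>, the tangent lengths from \<open>P\<close>
  are the semiperimeter \<open>s\<close>. Inserting this in the Gram relation between \<open>c - P\<close>, \<open>Q - P\<close> and
  \<open>R - P\<close> gives \<open>r (PQ + PR - QR) = 2 area(PQR)\<close>. The six small triangles have the
  same area, so each \<open>1 / r\<close> is, up to a common factor, a signed sum of side lengths, and all
  lengths cancel in the claimed identity.\<close>

text \<open>Twice the signed area of the triangle \<open>0\<close>, \<open>u\<close>,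
  \<open>v\<close>.\<close>

definition cross2 :: "real^2 \<Rightarrow> real^2 \<Rightarrow> real" where
  "cross2 u v = u$1 * v$2 - u$2 * v$1"

lemma cross2_sq: "(cross2 u v)\<^sup>2 = (norm u)\<^sup>2 * (norm v)\<^sup>2 - (u \<bullet> v)\<^sup>2"
  unfolding power2_norm_eq_inner cross2_def inner_vec_def sum_2 inner_real_def
  by (simp add: power2_eq_square algebra_simps)

text \<open>By Lagrange's identity \<open>cross2_sq\<close>, a vanishing \<open>cross2\<close> is
  the equality case of Cauchy-Schwarz.\<close>

lemma collinear_if_cross2_eq_0:
  assumes "cross2 (Q - P) (R - P) = 0"
  shows "collinear {P, Q, R}"
proof -
  have "((Q - P) \<bullet> (R - P))\<^sup>2 = (norm (Q - P) * norm (R - P))\<^sup>2"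
    using cross2_sq[of "Q - P" "R - P"] assms by (simp add: power_mult_distrib)
  then have "\<bar>(Q - P) \<bullet> (R - P)\<bar> = norm (Q - P) * norm (R - P)"
    by (metis abs_ge_zero mult_nonneg_nonneg norm_ge_zero power2_abs power2_eq_iff_nonneg)
  then have "collinear {0, Q - P, R - P}"
    by (simp only: norm_cauchy_schwarz_equal)
  then have "collinear {Q, P, R}"
    by (subst collinear_3) (simp add: insert_commute)
  then show ?thesis
    by (simp add: insert_commute)
qed

text \<open>Three vectors in the plane are linearly dependent, so their Gram determinant vanishes.
  This is its expansion, with \<open>cross2_sq\<close> absorbing the minor of \<open>u\<close> and
  \<open>v\<close>.\<close>

lemma gram_plane:
  fixes c u v :: "real^2"
  shows "(norm c)\<^sup>2 * (cross2 u v)\<^sup>2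
    = (c \<bullet> u)\<^sup>2 * (norm v)\<^sup>2 + (c \<bullet> v)\<^sup>2 * (norm u)\<^sup>2 - 2 * (c \<bullet> u) * (c \<bullet> v) * (u \<bullet> v)"
  unfolding power2_norm_eq_inner cross2_def inner_vec_def sum_2 inner_real_def
  by (simp add: power2_eq_square algebra_simps)

text \<open>Reflecting the point of tangency in the foot of the perpendicular from \<open>c\<close> gives a second
  common point unless the radius is perpendicular to the line.\<close>

lemma circle_tangent_at_orthogonal:
  assumes "circle_tangent_at c r (affine hull {Q, R}) T"
  shows "(c - T) \<bullet> (R - Q) = 0"
proof -
  define u where "u = R - Q"
  define k where "k = 2 * ((c - T) \<bullet> u) / (u \<bullet> u)"
  have meet: "sphere c r \<inter> affine hull {Q, R} = {T}"
    using assms by (simp add: circle_tangent_at_def)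
  then have T: "dist c T = r" "T \<in> affine hull {Q, R}"
    unfolding set_eq_iff Int_iff mem_sphere singleton_iff by blast+
  have unique: "X = T" if "dist c X = r" "X \<in> affine hull {Q, R}" for X
    using meet that unfolding set_eq_iff Int_iff mem_sphere singleton_iff by blast
  \<comment> \<open>In the degenerate case \<open>Q = R\<close> both sides are 0.\<close>
  have ku: "k * (u \<bullet> u) = 2 * ((c - T) \<bullet> u)"
    by (cases "u = 0") (simp_all add: k_def)
  obtain t where t: "T = Q + t *\<^sub>R (R - Q)"
    using T(2) unfolding affine_hull_2_alt by blast
  have "T + k *\<^sub>R u = Q + (t + k) *\<^sub>R (R - Q)"
    by (simp add: t u_def algebra_simps)
  then have hull: "T + k *\<^sub>R u \<in> affine hull {Q, R}"
    by (auto simp: affine_hull_2_alt)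
  have "(norm (c - T - k *\<^sub>R u))\<^sup>2 = (norm (c - T))\<^sup>2 - 2 * k * ((c - T) \<bullet> u) + k * (k * (u \<bullet> u))"
    unfolding power2_norm_eq_inner
    by (simp add: inner_diff_left inner_diff_right inner_commute algebra_simps)
  also have "\<dots> = (norm (c - T))\<^sup>2"
    by (simp add: ku)
  finally have "dist c (T + k *\<^sub>R u) = r"
    using T(1) by (simp add: dist_norm diff_diff_eq)
  with unique hull have "k *\<^sub>R u = 0"
    by fastforce
  then show ?thesis
    using ku by (auto simp: u_def)
qed

text \<open>Pythagoras with the right angle at \<open>T\<close>. The right-hand side does not
  mention \<open>T\<close>, so all tangents from \<open>X\<close> to the circle have equal
  length.\<close>

lemma tangent_length_sq:
  assumes "circle_tangent_at c r (affine hull {Q, R}) T" and "X \<in> affine hull {Q, R}"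
  shows "(dist X T)\<^sup>2 = (dist c X)\<^sup>2 - r\<^sup>2"
proof -
  have T: "dist c T = r" "T \<in> affine hull {Q, R}"
    using assms(1) by (auto simp: circle_tangent_at_def)
  obtain t s where ts: "T = Q + t *\<^sub>R (R - Q)" "X = Q + s *\<^sub>R (R - Q)"
    using T(2) assms(2) by (auto simp: affine_hull_2_alt)
  then have "X - T = (s - t) *\<^sub>R (R - Q)"
    unfolding ts by (simp add: algebra_simps)
  then have orth: "(c - T) \<bullet> (X - T) = 0"
    using circle_tangent_at_orthogonal[OF assms(1)] by simp
  have "(norm (c - X))\<^sup>2 = (norm ((c - T) - (X - T)))\<^sup>2"
    by simp
  also have "\<dots> = (norm (c - T))\<^sup>2 + (norm (X - T))\<^sup>2"
    using orth unfolding power2_norm_eq_inner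
    by (simp only: inner_diff_left[of "c - T"] inner_diff_right[of _ "c - T"] inner_commute[of "X - T" "c - T"])
  finally show ?thesis
    using T(1) by (simp add: dist_norm)
qed

text \<open>Off the segment, \<open>T\<close> lies beyond \<open>Q\<close> or beyond
  \<open>P\<close>; betweenness is equality in the triangle inequality.\<close>

lemma affine_hull_diff_closed_segment:
  fixes P Q T :: "'a::euclidean_space"
  assumes "T \<in> affine hull {P, Q} - closed_segment P Q"
  shows "dist P T = dist P Q + dist Q T \<or> dist Q T = dist P Q + dist P T"
proof -
  have "collinear {P, Q, T}"
    using assms by (intro collinear_subset[OF collinear_affine_hull_collinear[THEN iffD2, OF collinear_2]])
      (auto intro: hull_inc)
  then have "between (Q, T) P \<or> between (T, P) Q \<or> between (P, Q) T"
    by (simp only: collinear_between_cases)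
  then have "between (Q, T) P \<or> between (T, P) Q"
    using assms by (simp add: between_mem_segment)
  then show ?thesis
    by (auto simp: between dist_commute)
qed

text \<open>Solving for \<open>1 / r\<close> makes the side lengths enter linearly over twice the
  area.\<close>

lemma exradius_formula:
  assumes "is_exradius P Q R r" and nz: "cross2 (Q - P) (R - P) \<noteq> 0"
  shows "1 / r = (dist P Q + dist P R - dist Q R) / \<bar>cross2 (Q - P) (R - P)\<bar>"
proof -
  obtain c T1 T2 T3 where T1: "T1 \<in> closed_segment Q R"
    and t1: "circle_tangent_at c r (affine hull {Q, R}) T1"
    and T2: "T2 \<in> affine hull {P, Q} - closed_segment P Q"
    and t2: "circle_tangent_at c r (affine hull {P, Q}) T2"
    and T3: "T3 \<in> affine hull {P, R} - closed_segment P R"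
    and t3: "circle_tangent_at c r (affine hull {P, R}) T3"
    using assms(1) unfolding is_exradius_def is_excircle_def by blast
  define p q a d x where "p = dist P Q" and "q = dist P R" and "a = dist Q R"
    and "d = (Q - P) \<bullet> (R - P)" and "x = dist P T2"
  define G where "G = (cross2 (Q - P) (R - P))\<^sup>2"
  have r: "r > 0"
    using t1 by (simp add: circle_tangent_at_def)
  have nonneg: "p \<ge> 0" "q \<ge> 0" "a \<ge> 0" "x \<ge> 0"
    by (simp_all add: p_def q_def a_def x_def)
  have d: "2 * d = p\<^sup>2 + q\<^sup>2 - a\<^sup>2"
    unfolding p_def q_def a_def d_def dist_norm power2_norm_eq_inner
    by (simp add: inner_diff_left inner_diff_right inner_commute)
  have G: "G = p\<^sup>2 * q\<^sup>2 - d\<^sup>2"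
    unfolding G_def cross2_sq by (simp add: p_def q_def d_def dist_norm norm_minus_commute)
  have "G > 0"
    using nz by (simp add: G_def)
  \<comment> \<open>Heron's formula, as \<open>G\<close> is four times the squared area; it makes
    the triangle inequality below strict.\<close>
  have G4: "4 * G = (p + q + a) * (p + q - a) * (a\<^sup>2 - (p - q)\<^sup>2)"
    using d G by algebra
  have triangle: "p + q > a"
  proof -
    have "p + q \<ge> a"
      using dist_triangle[of Q R P] by (simp add: p_def q_def a_def dist_commute)
    moreover have "p + q \<noteq> a"
      using G4 \<open>G > 0\<close> by auto
    ultimately show ?thesis by simp
  qed
  have "(dist P T2)\<^sup>2 = (dist P T3)\<^sup>2" "(dist Q T2)\<^sup>2 = (dist Q T1)\<^sup>2" "(dist R T3)\<^sup>2 = (dist R T1)\<^sup>2"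
    using tangent_length_sq[OF t1] tangent_length_sq[OF t2] tangent_length_sq[OF t3]
    by (simp_all add: hull_inc)
  then have eqs: "dist P T3 = x" "dist Q T2 = dist Q T1" "dist R T3 = dist R T1"
    by (simp_all add: x_def)
  have a: "dist Q T1 + dist R T1 = a"
    using T1 by (simp add: a_def between dist_commute flip: between_mem_segment)
  have "x = p + dist Q T1 \<or> dist Q T1 = p + x"
    using affine_hull_diff_closed_segment[OF T2] eqs by (simp add: p_def x_def)
  moreover have "x = q + dist R T1 \<or> dist R T1 = q + x"
    using affine_hull_diff_closed_segment[OF T3] eqs by (simp add: q_def x_def)
  \<comment> \<open>A tangency point beyond \<open>P\<close>, that is
    \<open>dist Q T1 = p + x\<close> or \<open>dist R T1 = q + x\<close>, would force
    \<open>a \<ge> p + q\<close>.\<close>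
  ultimately have QT: "dist Q T1 = x - p" and RT: "dist R T1 = x - q"
    using a triangle nonneg zero_le_dist[of Q T1] zero_le_dist[of R T1] by linarith+
  then have x: "2 * x = p + q + a"
    using a by linarith
  have "x\<^sup>2 = (dist c P)\<^sup>2 - r\<^sup>2"
    using tangent_length_sq[OF t2, of P] by (simp add: x_def hull_inc)
  then have cP: "(dist c P)\<^sup>2 = x\<^sup>2 + r\<^sup>2"
    by simp
  have cQ: "(dist c Q)\<^sup>2 = (x - p)\<^sup>2 + r\<^sup>2" and cR: "(dist c R)\<^sup>2 = (x - q)\<^sup>2 + r\<^sup>2"
    using tangent_length_sq[OF t1, of Q] tangent_length_sq[OF t1, of R] QT RT
    by (simp_all add: hull_inc)
  \<comment> \<open>The law of cosines turns the distances from \<open>c\<close> into the inner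
    products of the Gram relation.\<close>
  have polar: "2 * ((c - P) \<bullet> (X - P)) = (dist c P)\<^sup>2 + (dist P X)\<^sup>2 - (dist c X)\<^sup>2" for X
    unfolding dist_norm power2_norm_eq_inner
    by (simp add: inner_diff_left inner_diff_right inner_commute)
  have "2 * ((c - P) \<bullet> (Q - P)) = 2 * (x * p)" "2 * ((c - P) \<bullet> (R - P)) = 2 * (x * q)"
    unfolding polar cP cQ cR p_def[symmetric] q_def[symmetric]
    by (simp_all add: power2_eq_square algebra_simps)
  then have inner: "(c - P) \<bullet> (Q - P) = x * p" "(c - P) \<bullet> (R - P) = x * q"
    by simp_all
  have "(x\<^sup>2 + r\<^sup>2) * G = (x * p)\<^sup>2 * q\<^sup>2 + (x * q)\<^sup>2 * p\<^sup>2 - 2 * (x * p) * (x * q) * d"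
    using gram_plane[of "c - P" "Q - P" "R - P"] cP unfolding inner
    by (simp add: G_def d_def p_def q_def dist_norm norm_minus_commute)
  \<comment> \<open>Here \<open>G\<close> factors as
    \<open>(p * q - d) * (p * q + d)\<close>.\<close>
  then have rG: "r\<^sup>2 * G = (x * (p * q - d))\<^sup>2"
    using G by algebra
  \<comment> \<open>The second factor of \<open>G\<close> appears since
    \<open>2 * x * (p + q - a) = (p + q)^2 - a^2 = 2 * (p * q + d)\<close>.\<close>
  have "2 * G = 2 * (x * (p * q - d) * (p + q - a))"
    using G d x by algebra
  then have "G\<^sup>2 = (x * (p * q - d))\<^sup>2 * (p + q - a)\<^sup>2"
    by (simp add: power_mult_distrib)
  also have "\<dots> = G * (r * (p + q - a))\<^sup>2"
    unfolding rG[symmetric] by (simp add: power_mult_distrib)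
  finally have "(r * (p + q - a))\<^sup>2 = G"
    using \<open>G > 0\<close> by (simp add: power2_eq_square)
  then have "\<bar>r * (p + q - a)\<bar> = \<bar>cross2 (Q - P) (R - P)\<bar>"
    unfolding G_def by (simp only: power2_eq_iff abs_eq_iff)
  then have "r * (p + q - a) = \<bar>cross2 (Q - P) (R - P)\<bar>"
    using r triangle by simp
  then show ?thesis
    using r nz by (simp add: p_def q_def a_def field_simps)
qed

theorem theorem3p2:
  fixes A B C D E F M :: "real^2"
    and r1 r2 r3 r4 r5 r6 :: real
  assumes "\<not> collinear {A, B, C}"
    and "D = midpoint B C" and "E = midpoint C A" and "F = midpoint A B"
    and "M = centroid A B C"
    and "is_exradius M B D r1"
    and "is_exradius M D C r2"
    and "is_exradius M C E r3"
    and "is_exradius M E A r4"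
    and "is_exradius M A F r5"
    and "is_exradius M F B r6"
  shows "1 / r1 + 1 / r3 + 1 / r5 = 1 / r2 + 1 / r4 + 1 / r6"
proof -
  define K where "K = cross2 (B - A) (C - A) / 6"
  have K: "K \<noteq> 0"
    using assms(1) collinear_if_cross2_eq_0[of B A C] by (auto simp: K_def)
  \<comment> \<open>The medians cut the triangle into six parts of equal area. Going round
    \<open>M\<close> in cyclic order gives them all the same orientation, hence the same
    sign.\<close>
  have cross: "cross2 (B - M) (D - M) = K" "cross2 (D - M) (C - M) = K"
    "cross2 (C - M) (E - M) = K" "cross2 (E - M) (A - M) = K"
    "cross2 (A - M) (F - M) = K" "cross2 (F - M) (B - M) = K"
    unfolding assms(2-5) K_def cross2_def centroid_def midpoint_def
    by (simp_all add: field_simps)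
  have mid: "dist D C = dist B D" "dist E A = dist C E" "dist F B = dist A F"
    by (simp_all add: assms(2-4) dist_midpoint)
  note [simp] = exradius_formula[OF assms(6)] exradius_formula[OF assms(7)]
    exradius_formula[OF assms(8)] exradius_formula[OF assms(9)]
    exradius_formula[OF assms(10)] exradius_formula[OF assms(11)]
  show ?thesis
    \<comment> \<open>Times the absolute value of \<open>K\<close>, each side is the sum of the
      distances from \<open>M\<close> to all six points minus half the perimeter of
      \<open>ABC\<close>.\<close>
    using K by (simp add: cross mid flip: add_divide_distrib)
qed

end
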